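(* For any $m\ge0$, $\left|\mathcal{O}^{-1}_{\mathrm{MVP}_{m+2}}(\beta_{m,2})\right|=m+1+\left\lfloor\frac{(m+1)^2}{2}\right\rfloor$, where $\beta_{m,2}=3\,4\cdots(m+2)\,1\,2\in S_{m+2}$.
   Context: For $N\ge1$, $[N]=\{1,\dots,N\}$. In the MVP parking process for a preference $p\in[N]^N$, cars $1,\dots,N$ enter in order a one-way street with spots $1,\dots,N$; car $i$ parks in spot $p_i$, and if $p_i$ was occupied by an earlier car $j$, car $j$ is bumped and parks in the first unoccupied spot $k>p_i$ (bumped cars do not bump others). $p$ is an MVP parking function if all cars park. The outcome $\mathcal{O}_{\mathrm{MVP}_N}(p)$ is the permutation $\pi$ with $\pi_i$ the car in spot $i$ at the end, and $\mathcal{O}^{-1}_{\mathrm{MVP}_N}(\pi)$ is the set of MVP parking functions of length $N$ with outcome $\pi$. For $m,n\ge0$, $\beta_{m,n}=(n+1)(n+2)\cdots(n+m)\,1\,2\cdots n$ (one-line notation); in particular $\beta_{0,2}=12$. *)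

theory Defs
  imports Main
begin

text \<open>
  A street is a partial map from spots to cars. If a bumped car finds no
  unoccupied spot ahead, it leaves the street unparked and the process goes on.
\<close>

definition mvp_step :: "nat \<Rightarrow> nat \<Rightarrow> nat \<Rightarrow> (nat \<Rightarrow> nat option) \<Rightarrow> (nat \<Rightarrow> nat option)" where
  "mvp_step N i q s =
     (case s q of
        None \<Rightarrow> s(q := Some i)
      | Some j \<Rightarrow>
          (let F = {k \<in> {q<..N}. s k = None} in
           if F = {} then s(q := Some i) else s(q := Some i, Min F := Some j)))"

text \<open>
  Cars and spots are numbered from 1 and list positions from 0, so the preference of
  car \<open>i\<close> is \<open>p ! (i - 1)\<close>. In \<open>mvp_street N p i\<close> the cars \<open>1, \<dots>, i\<close> have entered.
\<close>

primrec mvp_street :: "nat \<Rightarrow> nat list \<Rightarrow> nat \<Rightarrow> (nat \<Rightarrow> nat option)" where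
  "mvp_street N p 0 = (\<lambda>_. None)"
| "mvp_street N p (Suc i) = mvp_step N (Suc i) (p ! i) (mvp_street N p i)"

definition mvp_preferences :: "nat \<Rightarrow> nat list set" where
  "mvp_preferences N = {p. length p = N \<and> set p \<subseteq> {1..N}}"

definition mvp_parking_functions :: "nat \<Rightarrow> nat list set" where
  "mvp_parking_functions N =
     {p \<in> mvp_preferences N. \<forall>i\<in>{1..N}. \<exists>k\<in>{1..N}. mvp_street N p N k = Some i}"

text \<open>The outcome is a permutation in one-line notation.\<close>

definition mvp_outcome :: "nat \<Rightarrow> nat list \<Rightarrow> nat list" where
  "mvp_outcome N p = map (\<lambda>k. the (mvp_street N p N k)) [1..<Suc N]"

definition mvp_fibre :: "nat \<Rightarrow> nat list \<Rightarrow> nat list set" where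
  "mvp_fibre N \<pi> = {p \<in> mvp_parking_functions N. mvp_outcome N p = \<pi>}"

definition beta_perm :: "nat \<Rightarrow> nat \<Rightarrow> nat list" where
  "beta_perm m n = [n + 1..<n + m + 1] @ [1..<n + 1]"

lemma mvp_street_full:
  assumes "p \<in> mvp_parking_functions N"
  shows "mvp_street N p N ` {1..N} = Some ` {1..N}"
proof -
  have sub: "Some ` {1..N} \<subseteq> mvp_street N p N ` {1..N}"
    using assms unfolding mvp_parking_functions_def by force
  have "card (mvp_street N p N ` {1..N}) \<le> card (Some ` {1..N})"
    using card_image_le[of "{1..N}" "mvp_street N p N"] by (simp add: card_image)
  with sub show ?thesis
    by (metis card_seteq finite_atLeastAtMost finite_imageI)
qed

lemma mvp_outcome_permutation:
  assumes "p \<in> mvp_parking_functions N"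
  shows "set (mvp_outcome N p) = {1..N}" and "distinct (mvp_outcome N p)"
proof -
  have "set (mvp_outcome N p) = the ` mvp_street N p N ` {1..N}"
    by (auto simp: mvp_outcome_def image_image atLeastLessThanSuc_atLeastAtMost simp del: upt_Suc)
  also have "\<dots> = {1..N}"
    by (simp only: mvp_street_full[OF assms] image_image option.sel image_ident)
  finally show s: "set (mvp_outcome N p) = {1..N}" .
  show "distinct (mvp_outcome N p)"
    by (rule card_distinct) (simp add: s, simp add: mvp_outcome_def del: upt_Suc)
qed

end

theory Submission
  imports Defs
begin

text \<open>
  Cars only ever move to the right, so by induction each car \<open>j \<ge> 3\<close> must choose its final spot
  \<open>j - 2\<close>: otherwise it would evict an earlier car from that car's final spot. Only the preferences
  \<open>x\<close>, \<open>y\<close> of the cars 1 and 2 remain free. The cars \<open>3, 4, \<dots>\<close> sweep the street from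
  left to right. Whenever the cars 1 and 2 are adjacent at the front of the sweep, the left one
  jumps over the right one, and the position \<open>v\<close> of the rightmost of the two advances by one.
  Hence the parity of \<open>N - v\<close> together with the relative order of the cars 1 and 2 is an invariant
  of the sweep, which decides the outcome. The case \<open>x = y\<close> puts car 2 at \<open>x\<close> and car 1 at
  \<open>x + 1\<close>, and contributes the additional solutions besides one for each pair of distinct spots.
\<close>

declare add_2_eq_Suc [simp del] add_2_eq_Suc' [simp del] mvp_street.simps(2) [simp del]

section \<open>Single parking steps and the movement of cars along the street\<close>

lemma mvp_step_cases:
  obtains (free) "s q = None" "mvp_step N i q s = s(q := Some i)"
  | (lost) j where "s q = Some j" "mvp_step N i q s = s(q := Some i)"
  | (bump) j k where "s q = Some j" "q < k" "k \<le> N" "s k = None"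
      "mvp_step N i q s = s(q := Some i, k := Some j)"
proof (cases "s q")
  case None
  then show ?thesis using free by (simp add: mvp_step_def)
next
  case (Some j)
  define F where "F = {k \<in> {q<..N}. s k = None}"
  show ?thesis
  proof (cases "F = {}")
    case True
    then show ?thesis using Some lost by (simp add: mvp_step_def F_def)
  next
    case False
    have "finite F" by (simp add: F_def)
    then have "Min F \<in> F" using False by simp
    then have "q < Min F" "Min F \<le> N" "s (Min F) = None" by (simp_all add: F_def)
    moreover have "mvp_step N i q s = s(q := Some i, Min F := Some j)"
      using Some False unfolding mvp_step_def F_def[symmetric] Let_def by simp
    ultimately show ?thesis using Some bump by blast
  qed
qed

lemma mvp_step_at: "mvp_step N i q s q = Some i"
  by (rule mvp_step_cases[of s q N i]) auto

lemma mvp_step_cases_at: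
  assumes "mvp_step N i q s k = Some j"
  shows "k = q \<and> j = i \<or> s k = Some j \<and> k \<noteq> q \<or> q < k \<and> s q = Some j \<and> s k = None"
  using assms by (cases rule: mvp_step_cases[of s q N i]) (auto split: if_splits)

lemma mvp_street_le:
  "mvp_street N p i k = Some j \<Longrightarrow> j \<le> i"
proof (induction i arbitrary: k j)
  case (Suc i)
  from mvp_step_cases_at[OF Suc.prems[unfolded mvp_street.simps]] Suc.IH show ?case by fastforce
qed simp

text \<open>A bumped car leaves its old spot as it takes the new one, and by
  \<open>mvp_street_le\<close> the entering car is not yet on the street.\<close>

lemma mvp_street_inj:
  "mvp_street N p i k = Some j \<Longrightarrow> mvp_street N p i k' = Some j \<Longrightarrow> k = k'"
proof (induction i arbitrary: k k' j)
  case (Suc i)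
  let ?s = "mvp_street N p i"
  have le: "j \<le> i" if "?s k = Some j" for k j using mvp_street_le that .
  have new: "?s l \<noteq> Some (Suc i)" for l using le by fastforce
  show ?case
    using Suc.IH new Suc.prems
    by (cases rule: mvp_step_cases[of ?s "p ! i" N "Suc i"]) (auto simp: mvp_street.simps(2) split: if_splits)
qed simp

text \<open>Bumps lead to the right only and a lost car never returns, so a car found at
  \<open>k\<close> has been on the street since its entry, never to the right of
  \<open>k\<close>.\<close>

lemma mvp_street_trace_back:
  assumes "i \<le> i'" "mvp_street N p i' k = Some j" "j \<le> i"
  shows "\<exists>k'\<le>k. mvp_street N p i k' = Some j"
  using assms
proof (induction i' arbitrary: k rule: dec_induct)
  case base
  then show ?case by blast
next
  case (step n)
  have "j \<noteq> Suc n" using step.prems(2) step.hyps by simp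
  with mvp_step_cases_at[OF step.prems(1)[unfolded mvp_street.simps]]
  obtain l where "l \<le> k" "mvp_street N p n l = Some j" by (meson less_imp_le order_refl)
  with step.IH step.prems(2) show ?case by (meson order.trans)
qed

lemma mvp_street_own: "mvp_street N p (Suc i) (p ! i) = Some (Suc i)"
  by (simp add: mvp_street.simps(2) mvp_step_at)

section \<open>Final streets in the fibre and the forced preferences\<close>

lemma beta_perm_nth:
  assumes "k < m + 2"
  shows "beta_perm m 2 ! k = (if k < m then k + 3 else k + 1 - m)"
  using assms by (auto simp: beta_perm_def nth_append simp del: upt_Suc)

lemma mvp_fibre_street:
  "p \<in> mvp_fibre (m + 2) (beta_perm m 2) \<longleftrightarrow> p \<in> mvp_preferences (m + 2) \<and>
     (\<forall>k\<in>{1..m + 2}. mvp_street (m + 2) p (m + 2) k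
        = Some (if k \<le> m then k + 2 else k - m))" (is "?L \<longleftrightarrow> ?R")
proof
  assume L: ?L
  then have p: "p \<in> mvp_parking_functions (m + 2)"
    and o: "mvp_outcome (m + 2) p = beta_perm m 2" by (auto simp: mvp_fibre_def)
  have "mvp_street (m + 2) p (m + 2) k = Some (if k \<le> m then k + 2 else k - m)"
    if k: "k \<in> {1..m + 2}" for k
  proof -
    \<comment> \<open>A value of \<open>the\<close> identifies the occupant only once the spot is
      known to be occupied.\<close>
    have "mvp_street (m + 2) p (m + 2) k \<in> Some ` {1..m + 2}"
      using mvp_street_full[OF p] k by blast
    moreover have "the (mvp_street (m + 2) p (m + 2) k) = mvp_outcome (m + 2) p ! (k - 1)"
      using k by (auto simp: mvp_outcome_def simp del: upt_Suc)
    ultimately show ?thesis using k by (auto simp: o beta_perm_nth)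
  qed
  then show ?R using p by (auto simp: mvp_parking_functions_def)
next
  assume R: ?R
  have "\<exists>k\<in>{1..m + 2}. mvp_street (m + 2) p (m + 2) k = Some i" if "i \<in> {1..m + 2}" for i
  proof (cases "i \<le> 2")
    case True
    then show ?thesis using R that by (intro bexI[of _ "m + i"]) auto
  next
    case False
    then have "i - 2 \<in> {1..m + 2}" "i - 2 \<le> m" "i - 2 + 2 = i" using that by auto
    then show ?thesis using R by metis
  qed
  moreover have "mvp_outcome (m + 2) p = beta_perm m 2"
  proof (rule nth_equalityI)
    show "length (mvp_outcome (m + 2) p) = length (beta_perm m 2)"
      by (simp add: mvp_outcome_def beta_perm_def del: upt_Suc)
    fix k assume "k < length (mvp_outcome (m + 2) p)"
    then have k: "k < m + 2" by (simp add: mvp_outcome_def del: upt_Suc)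
    then have "mvp_outcome (m + 2) p ! k = the (mvp_street (m + 2) p (m + 2) (Suc k))"
      by (simp add: mvp_outcome_def del: upt_Suc)
    then show "mvp_outcome (m + 2) p ! k = beta_perm m 2 ! k"
      using R k by (auto simp: beta_perm_nth)
  qed
  ultimately show ?L using R by (auto simp: mvp_fibre_def mvp_parking_functions_def)
qed

lemma mvp_fibre_forced:
  assumes p: "p \<in> mvp_fibre (m + 2) (beta_perm m 2)" and "i < m"
  shows "p ! (i + 2) = i + 1"
  using \<open>i < m\<close>
proof (induction i rule: less_induct)
  case (less i)
  let ?s = "mvp_street (m + 2) p" and ?q = "p ! (i + 2)"
  have len: "length p = m + 2" "set p \<subseteq> {1..m + 2}"
    using p by (auto simp: mvp_fibre_street mvp_preferences_def)
  have q1: "1 \<le> ?q" using len less.prems nth_mem[of "i + 2" p] by fastforce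
  have fin: "?s (m + 2) (k + 1) = Some (k + 3)" if "k < m" for k
    using p that by (auto simp: mvp_fibre_street)
  have own: "?s (i + 3) ?q = Some (i + 3)"
    using mvp_street_own[of "m + 2" p "i + 2"] by (simp add: eval_nat_numeral)
  \<comment> \<open>Car \<open>i + 3\<close> ends in spot \<open>i + 1\<close>, so it cannot have
    entered further right.\<close>
  obtain k where "k \<le> i + 1" "?s (i + 3) k = Some (i + 3)"
    using mvp_street_trace_back[OF _ fin[OF less.prems], of "i + 3"] less.prems by auto
  then have qle: "?q \<le> i + 1" using mvp_street_inj own by metis
  show ?case
  proof (rule ccontr)
    assume "?q \<noteq> i + 1"
    with qle q1 obtain l where l: "?q = l + 1" "l < i"
      by (metis add.commute le_Suc_ex le_neq_implies_less add_less_cancel_right)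
    have "p ! (l + 2) = l + 1" using less l by simp
    then have own': "?s (l + 3) (l + 1) = Some (l + 3)"
      using mvp_street_own[of "m + 2" p "l + 2"] by (simp add: eval_nat_numeral)
    \<comment> \<open>Car \<open>l + 3\<close> must end in its entry spot \<open>l + 1\<close>,
      which car \<open>i + 3\<close> has just taken. At that moment it is therefore strictly left of
      \<open>l + 1\<close>, and tracing it back to its entry contradicts
      \<open>own'\<close>.\<close>
    obtain k where k: "k \<le> l + 1" "?s (i + 3) k = Some (l + 3)"
      using mvp_street_trace_back[OF _ fin[of l], of "i + 3"] less.prems l by auto
    moreover have "k \<noteq> l + 1" using k own l by auto
    moreover obtain k' where "k' \<le> k" "?s (l + 3) k' = Some (l + 3)"
      using mvp_street_trace_back[OF _ k(2), of "l + 3"] l by auto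
    ultimately show False using mvp_street_inj[OF own', of k'] by auto
  qed
qed

section \<open>The street while the cars 3, 4, ... sweep it\<close>

text \<open>Models the street after \<open>t + 2\<close> cars, with \<open>t < u\<close> and
  \<open>u < v\<close>. The arguments \<open>a\<close> and \<open>b\<close> name the left and the
  right one of the cars 1 and 2, so a jump swaps them.\<close>

definition sweep_street :: "nat \<Rightarrow> nat \<Rightarrow> nat \<Rightarrow> nat \<Rightarrow> nat \<Rightarrow> nat \<Rightarrow> nat option" where
  "sweep_street t u v a b = (\<lambda>k. if 1 \<le> k \<and> k \<le> t then Some (k + 2)
     else if k = u then Some a else if k = v then Some b else None)"

lemma mvp_step_bump:
  assumes "s q = Some j" "q < k" "k \<le> N" "s k = None" "\<And>l. q < l \<Longrightarrow> l < k \<Longrightarrow> s l \<noteq> None"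
  shows "mvp_step N i q s = s(q := Some i, k := Some j)"
proof -
  have "Min {k \<in> {q<..N}. s k = None} = k"
  proof (rule Min_eqI)
    fix l assume "l \<in> {k \<in> {q<..N}. s k = None}"
    then show "k \<le> l" using assms(5)[of l] by fastforce
  qed (use assms in auto)
  moreover have "k \<in> {k \<in> {q<..N}. s k = None}" using assms by simp
  ultimately show ?thesis using assms(1) by (auto simp: mvp_step_def Let_def)
qed

text \<open>Car \<open>t + 3\<close> either finds its spot free or bumps the left car, which moves
  one spot on or, if the right car is there, jumps over it. For the jump,
  \<open>t + 3 \<le> N\<close> guarantees a landing spot.\<close>

lemma sweep_street_step:
  assumes "t < u" "u < v" "v \<le> N" "t + 3 \<le> N"
  shows "mvp_step N (t + 3) (t + 1) (sweep_street t u v a b) =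
    (if t + 1 < u then sweep_street (t + 1) u v a b
     else if t + 2 < v then sweep_street (t + 1) (t + 2) v a b
     else sweep_street (t + 1) (t + 2) (t + 3) b a)"
proof -
  let ?s = "sweep_street t u v a b"
  consider "t + 1 < u" | "u = t + 1" "t + 2 < v" | "u = t + 1" "v = t + 2"
    using assms by linarith
  then show ?thesis
  proof cases
    case 1
    then have "?s (t + 1) = None" using assms by (simp add: sweep_street_def)
    then show ?thesis using 1 assms
      by (auto simp: mvp_step_def sweep_street_def fun_eq_iff)
  next
    case 2
    then have "mvp_step N (t + 3) (t + 1) ?s = ?s(t + 1 := Some (t + 3), t + 2 := Some a)"
      using assms by (intro mvp_step_bump) (auto simp: sweep_street_def)
    then show ?thesis using 2 by (auto simp: sweep_street_def fun_eq_iff)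
  next
    case 3
    then have "mvp_step N (t + 3) (t + 1) ?s = ?s(t + 1 := Some (t + 3), t + 3 := Some a)"
      using assms by (intro mvp_step_bump) (auto simp: sweep_street_def)
    then show ?thesis using 3 by (auto simp: sweep_street_def fun_eq_iff)
  qed
qed

text \<open>Only a jump changes \<open>v'\<close>, and it also swaps \<open>a'\<close> and
  \<open>b'\<close>. The sum \<open>m + v\<close> has the parity of \<open>N - v\<close> for
  \<open>N = m + 2\<close> and avoids truncated subtraction.\<close>

lemma sweep_invariant:
  assumes start: "mvp_street (m + 2) p 2 = sweep_street 0 u v a b"
    and forced: "\<And>i. i < m \<Longrightarrow> p ! (i + 2) = i + 1"
    and uv: "0 < u" "u < v" "v \<le> m + 2" and "t \<le> m"
  shows "\<exists>u' v' a' b'. mvp_street (m + 2) p (t + 2) = sweep_street t u' v' a' b' \<and>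
    t < u' \<and> u' < v' \<and> v' \<le> m + 2 \<and>
    (a', b') = (if even (m + v) = even (m + v') then (a, b) else (b, a))"
  using \<open>t \<le> m\<close>
proof (induction t)
  case 0
  have "mvp_street (m + 2) p (0 + 2) = sweep_street 0 u v a b" using start by simp
  with uv show ?case by (intro exI[of _ u] exI[of _ v] exI[of _ a] exI[of _ b]) simp
next
  case (Suc t)
  then obtain u' v' a' b' where
    s: "mvp_street (m + 2) p (t + 2) = sweep_street t u' v' a' b'"
    and uv': "t < u'" "u' < v'" "v' \<le> m + 2"
    and ab: "(a', b') = (if even (m + v) = even (m + v') then (a, b) else (b, a))" by auto
  have "mvp_street (m + 2) p (Suc t + 2) =
      mvp_step (m + 2) (t + 3) (p ! (t + 2)) (mvp_street (m + 2) p (t + 2))"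
    by (simp add: mvp_street.simps(2) eval_nat_numeral)
  also have "\<dots> = mvp_step (m + 2) (t + 3) (t + 1) (sweep_street t u' v' a' b')"
    using forced[of t] Suc.prems by (simp add: s)
  also have "\<dots> = (if t + 1 < u' then sweep_street (t + 1) u' v' a' b'
     else if t + 2 < v' then sweep_street (t + 1) (t + 2) v' a' b'
     else sweep_street (t + 1) (t + 2) (t + 3) b' a')"
    using sweep_street_step[OF uv'] Suc.prems by simp
  finally have e: "mvp_street (m + 2) p (Suc t + 2) = \<dots>" .
  consider "t + 1 < u'" | "u' = t + 1" "t + 2 < v'" | "u' = t + 1" "v' = t + 2"
    using uv' by linarith
  then show ?case
  proof cases
    case 1
    then show ?thesis using uv' ab unfolding e
      by (intro exI[of _ u'] exI[of _ v'] exI[of _ a'] exI[of _ b']) simp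
  next
    case 2
    then show ?thesis using uv' ab unfolding e
      by (intro exI[of _ "t + 2"] exI[of _ v'] exI[of _ a'] exI[of _ b']) simp
  next
    case 3
    \<comment> \<open>The jump takes the rightmost position from \<open>t + 2\<close> to
      \<open>t + 3\<close>, so parity and order flip together.\<close>
    have "(b', a') = (if even (m + v) = even (m + (t + 3)) then (a, b) else (b, a))"
      using ab unfolding 3 by (cases "even m"; cases "even t"; cases "even v") simp_all
    moreover have "mvp_street (m + 2) p (Suc t + 2) = sweep_street (Suc t) (t + 2) (t + 3) b' a'"
      using 3 unfolding e by simp
    moreover have "Suc t < t + 2" "t + 2 < t + 3" "t + 3 \<le> m + 2" using Suc.prems by auto
    ultimately show ?thesis by blast
  qed
qed

text \<open>After the sweep only the spots \<open>m + 1\<close> and \<open>m + 2\<close> are left,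
  so \<open>v' = m + 2\<close> and \<open>m + v'\<close> is even. The initial order thus survives
  exactly for even \<open>m + v\<close>, and the outcome requires car 1 on the left.\<close>

lemma mvp_fibre_iff_parity:
  assumes start: "mvp_street (m + 2) p 2 = sweep_street 0 u v a b"
    and forced: "\<And>i. i < m \<Longrightarrow> p ! (i + 2) = i + 1"
    and uv: "0 < u" "u < v" "v \<le> m + 2" and ab: "(a, b) = (1, 2) \<or> (a, b) = (2, 1)"
    and p: "p \<in> mvp_preferences (m + 2)"
  shows "p \<in> mvp_fibre (m + 2) (beta_perm m 2) \<longleftrightarrow> (a = 1 \<longleftrightarrow> even (m + v))"
proof -
  obtain u' v' a' b' where
    s: "mvp_street (m + 2) p (m + 2) = sweep_street m u' v' a' b'"
    and uv': "m < u'" "u' < v'" "v' \<le> m + 2"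
    and ab': "(a', b') = (if even (m + v) = even (m + v') then (a, b) else (b, a))"
    using sweep_invariant[OF start forced uv order_refl] by blast
  from uv' have u': "u' = m + 1" and v': "v' = m + 2" by linarith+
  have R: "{1..m + 2} = insert (m + 1) (insert (m + 2) {1..m})" by auto
  define e where "e \<longleftrightarrow> even (m + v)"
  have "p \<in> mvp_fibre (m + 2) (beta_perm m 2) \<longleftrightarrow> a' = 1 \<and> b' = 2"
    unfolding mvp_fibre_street s R u' v' using p by (simp add: sweep_street_def)
  moreover have "(a', b') = (if e then (a, b) else (b, a))"
    using ab' unfolding v' e_def by simp
  ultimately show ?thesis using ab unfolding e_def[symmetric] by (elim disjE; cases e; simp)
qed

section \<open>Admissible preferences of the cars 1 and 2\<close>

text \<open>The parity criterion for each initial position: car 1 on the left, car 2 on the left,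
  and equal preferences. In the last case the rightmost position is \<open>x + 1\<close>, which
  shifts the parity, and \<open>x < N\<close> keeps car 1 on the street.\<close>

definition leading_pairs :: "nat \<Rightarrow> (nat \<times> nat) set" where
  "leading_pairs N = {(x, y). 1 \<le> x \<and> x \<le> N \<and> 1 \<le> y \<and> y \<le> N \<and>
     (x < y \<and> even (N + y) \<or> y < x \<and> odd (N + x) \<or> x = y \<and> x < N \<and> even (N + x))}"

lemma mvp_fibre_iff_leading_pair:
  assumes p: "p \<in> mvp_preferences (m + 2)"
    and forced: "\<And>i. i < m \<Longrightarrow> p ! (i + 2) = i + 1"
  shows "p \<in> mvp_fibre (m + 2) (beta_perm m 2) \<longleftrightarrow> (p ! 0, p ! 1) \<in> leading_pairs (m + 2)"
proof -
  define x y where "x = p ! 0" and "y = p ! 1"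
  have "length p = m + 2" "set p \<subseteq> {1..m + 2}" using p by (auto simp: mvp_preferences_def)
  moreover from this have "x \<in> set p" "y \<in> set p" by (simp_all add: x_def y_def)
  ultimately have xy: "1 \<le> x" "x \<le> m + 2" "1 \<le> y" "y \<le> m + 2" by auto
  have s1: "mvp_street (m + 2) p 1 = [x \<mapsto> 1]"
    by (simp add: mvp_street.simps(2) x_def mvp_step_def)
  have s2: "mvp_street (m + 2) p 2 = mvp_step (m + 2) 2 y [x \<mapsto> 1]"
    using s1 by (simp add: mvp_street.simps(2) y_def eval_nat_numeral)
  note iff = mvp_fibre_iff_parity[OF _ forced _ _ _ _ p]
  consider "x < y" | "y < x" | "x = y" "x < m + 2" | "x = m + 2" "y = m + 2"
    using xy by linarith
  then show ?thesis
  proof cases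
    case 1
    then have "mvp_street (m + 2) p 2 = sweep_street 0 x y 1 2"
      using xy unfolding s2 by (auto simp: mvp_step_def sweep_street_def fun_eq_iff)
    from iff[OF this] show ?thesis using 1 xy
      unfolding x_def[symmetric] y_def[symmetric] by (auto simp: leading_pairs_def)
  next
    case 2
    then have "mvp_street (m + 2) p 2 = sweep_street 0 y x 2 1"
      using xy unfolding s2 by (auto simp: mvp_step_def sweep_street_def fun_eq_iff)
    from iff[OF this] show ?thesis using 2 xy
      unfolding x_def[symmetric] y_def[symmetric] by (auto simp: leading_pairs_def)
  next
    case 3
    then have "mvp_step (m + 2) 2 y [x \<mapsto> 1] = [x \<mapsto> 1, y \<mapsto> 2, x + 1 \<mapsto> 1]"
      by (intro mvp_step_bump) auto
    then have "mvp_street (m + 2) p 2 = sweep_street 0 x (x + 1) 2 1"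
      using 3 xy unfolding s2 by (auto simp: sweep_street_def fun_eq_iff)
    from iff[OF this] show ?thesis using 3 xy
      unfolding x_def[symmetric] y_def[symmetric] by (auto simp: leading_pairs_def)
  next
    case 4
    \<comment> \<open>Car 2 evicts car 1 from the last spot, and car 1 is lost, whereas the outcome
      has it in spot \<open>m + 1\<close>.\<close>
    have "p \<notin> mvp_fibre (m + 2) (beta_perm m 2)"
    proof
      assume "p \<in> mvp_fibre (m + 2) (beta_perm m 2)"
      then have "mvp_street (m + 2) p (m + 2) (m + 1) = Some 1"
        unfolding mvp_fibre_street by auto
      then obtain k where "mvp_street (m + 2) p 2 k = Some 1"
        using mvp_street_trace_back[of 2 "m + 2"] by fastforce
      moreover have "mvp_street (m + 2) p 2 = [m + 2 \<mapsto> 2]"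
        unfolding s2 4 by (simp add: mvp_step_def)
      ultimately show False by (simp split: if_splits)
    qed
    then show ?thesis using 4
      unfolding x_def[symmetric] y_def[symmetric] by (simp add: leading_pairs_def)
  qed
qed

lemma bij_betw_fibre_leading_pairs:
  "bij_betw (\<lambda>(x, y). [x, y] @ [1..<m + 1]) (leading_pairs (m + 2))
     (mvp_fibre (m + 2) (beta_perm m 2))"
proof (rule bij_betw_imageI)
  let ?f = "\<lambda>(x, y). [x, y] @ [1..<m + 1]"
  show "inj_on ?f (leading_pairs (m + 2))" by (auto simp: inj_on_def)
  show "?f ` leading_pairs (m + 2) = mvp_fibre (m + 2) (beta_perm m 2)"
  proof (intro subset_antisym subsetI)
    fix p assume "p \<in> ?f ` leading_pairs (m + 2)"
    then obtain x y where xy: "(x, y) \<in> leading_pairs (m + 2)" and p: "p = [x, y] @ [1..<m + 1]"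
      by auto
    have "p \<in> mvp_preferences (m + 2)"
      using xy by (auto simp: p mvp_preferences_def leading_pairs_def)
    moreover have "p ! (i + 2) = i + 1" if "i < m" for i using that by (simp add: p del: upt_Suc)
    ultimately show "p \<in> mvp_fibre (m + 2) (beta_perm m 2)"
      using xy by (subst mvp_fibre_iff_leading_pair) (auto simp: p)
  next
    fix p assume p: "p \<in> mvp_fibre (m + 2) (beta_perm m 2)"
    then have pref: "p \<in> mvp_preferences (m + 2)" by (simp add: mvp_fibre_street)
    have "p = [p ! 0, p ! 1] @ [1..<m + 1]"
    proof (rule nth_equalityI)
      show len: "length p = length ([p ! 0, p ! 1] @ [1..<m + 1])"
        using pref by (simp add: mvp_preferences_def)
      fix k assume "k < length p"
      then have k: "k < m + 2" using len by (simp del: upt_Suc)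
      consider "k = 0" | "k = 1" | i where "k = i + 2"
        by (metis One_nat_def add_2_eq_Suc' not0_implies_Suc)
      then show "p ! k = ([p ! 0, p ! 1] @ [1..<m + 1]) ! k"
        using k mvp_fibre_forced[OF p] by cases (auto simp del: upt_Suc)
    qed
    moreover have "(p ! 0, p ! 1) \<in> leading_pairs (m + 2)"
      using mvp_fibre_iff_leading_pair[OF pref mvp_fibre_forced[OF p]] p by simp
    ultimately show "p \<in> ?f ` leading_pairs (m + 2)" by (force simp del: upt_Suc)
  qed
qed

section \<open>Counting the admissible pairs\<close>

text \<open>Of the two orderings of any two distinct spots exactly one is admissible, selected by
  the parity of the larger spot; the diagonal is counted separately.\<close>

lemma card_leading_pairs:
  "card (leading_pairs (Suc n)) = n * (n + 1) div 2 + n div 2"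
proof -
  let ?N = "Suc n"
  \<comment> \<open>Pairs are stored with the larger spot first, since its parity decides the
    orientation under \<open>f\<close>.\<close>
  define A where "A = Sigma {..?N} (\<lambda>b. {1..<b})"
  define f where "f = (\<lambda>(b, a). if even (?N + b) then (a, b) else (b, a))"
  \<comment> \<open>A diagonal entry lies at a positive even distance \<open>2 * i\<close> below
    \<open>?N\<close>; being at least 1 means \<open>2 * i \<le> n\<close>.\<close>
  define g where "g = (\<lambda>i. (?N - 2 * i, ?N - 2 * i))"
  have fA: "f ` A = {(x, y) \<in> leading_pairs ?N. x \<noteq> y}" (is "_ = ?T")
  proof
    show "f ` A \<subseteq> ?T"
    proof (rule image_subsetI)
      fix z assume "z \<in> A"
      then show "f z \<in> ?T"
        by (cases z; cases "even (?N + fst z)") (auto simp: A_def f_def leading_pairs_def)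
    qed
    show "?T \<subseteq> f ` A"
    proof clarify
      fix x y assume "(x, y) \<in> leading_pairs ?N" "x \<noteq> y"
      then have "(x, y) = f (max x y, min x y)" "(max x y, min x y) \<in> A"
        by (auto simp: A_def f_def leading_pairs_def max_def min_def)
      then show "(x, y) \<in> f ` A" by blast
    qed
  qed
  have gB: "g ` {1..n div 2} = {(x, y) \<in> leading_pairs ?N. x = y}" (is "_ = ?D")
  proof
    show "g ` {1..n div 2} \<subseteq> ?D" by (auto simp: g_def leading_pairs_def)
    show "?D \<subseteq> g ` {1..n div 2}"
    proof clarify
      fix x assume x: "(x, x) \<in> leading_pairs ?N"
      then have "even (?N - x)" "1 \<le> x" "x < ?N" by (auto simp: leading_pairs_def)
      then obtain i where "?N - x = 2 * i" by (blast elim: evenE)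
      then have "(x, x) = g i" "i \<in> {1..n div 2}"
        using \<open>1 \<le> x\<close> \<open>x < ?N\<close> by (auto simp: g_def)
      then show "(x, x) \<in> g ` {1..n div 2}" by blast
    qed
  qed
  have "inj_on f A" by (auto simp: inj_on_def A_def f_def split: if_splits)
  then have "card (f ` A) = (\<Sum>b\<le>?N. b - 1)"
    unfolding A_def by (subst card_image) (auto simp: card_SigmaI)
  \<comment> \<open>The shift drops the term for \<open>b = 0\<close>, which truncated subtraction
    makes 0.\<close>
  also have "\<dots> = \<Sum>{..n}" by (simp add: sum.atMost_Suc_shift del: sum.atMost_Suc)
  also have "\<dots> = n * (n + 1) div 2" using gauss_sum_nat[of n] by (simp add: atMost_atLeast0)
  finally have cA: "card (f ` A) = n * (n + 1) div 2" .
  have "inj_on g {1..n div 2}" by (auto simp: inj_on_def g_def)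
  then have cB: "card (g ` {1..n div 2}) = n div 2" by (simp add: card_image)
  have "leading_pairs ?N = f ` A \<union> g ` {1..n div 2}" unfolding fA gB by auto
  moreover have "f ` A \<inter> g ` {1..n div 2} = {}" unfolding fA gB by auto
  moreover have "finite A" by (simp add: A_def)
  ultimately show ?thesis using cA cB by (simp add: card_Un_disjoint)
qed

theorem theorem4p2:
  fixes m :: nat
  shows "card (mvp_fibre (m + 2) (beta_perm m 2)) = m + 1 + (m + 1)\<^sup>2 div 2"
proof -
  \<comment> \<open>For odd \<open>n\<close> the second summand loses a half, just as
    \<open>n\<^sup>2 div 2\<close> does.\<close>
  have "n * (n + 1) div 2 + n div 2 = n + n\<^sup>2 div 2" for n :: nat
    by (cases "even n") (auto elim!: evenE oddE simp: power2_eq_square algebra_simps)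
  moreover have "Suc (m + 1) = m + 2" by simp
  ultimately show ?thesis
    using bij_betw_same_card[OF bij_betw_fibre_leading_pairs[of m]] card_leading_pairs[of "m + 1"]
    by metis
qed

end
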